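(* Let $(W,S)$ be a Coxeter system and let $\mathsf{w}$ be a torically reduced word in $S^*$. Then the set of total toric extensions of the toric heap of $\mathsf{w}$ equals the cyclic commutativity class of $[\mathsf{w}]$: \[\mathcal{L}_{\mathrm{tor}}(\mathcal{T}(\mathsf{w}))=\mathcal{C}_{\mathrm{tor}}([\mathsf{w}]).\]
   Context: $(W,S)$ is a Coxeter system with bond strengths $m(s,t)$ (order of $st$, with $m(s,s)=1$) and Coxeter graph $\Gamma$ (vertex set $S$, edge $\{s,t\}$ when $m(s,t)\ge3$). For distinct $s,t$ and $k\ge2$, $\langle s,t\rangle_k=stst\cdots$ ($k$ letters). A braid relation replaces a consecutive subword $\langle s,t\rangle_{m(s,t)}$ by $\langle t,s\rangle_{m(s,t)}$; it is a short braid relation if $m(s,t)=2$. Cyclic words: the cyclic word $[\mathsf{w}]$ of $\mathsf{w}=s_{x_1}\cdots s_{x_m}$ is the set of all cyclic shifts $s_{x_i}\cdots s_{x_m}s_{x_1}\cdots s_{x_{i-1}}$. Two cyclic words $[\mathsf{w}],[\mathsf{u}]$ differ by a (short) braid if some $\mathsf{w}'\in[\mathsf{w}]$ is converted to some $\mathsf{u}'\in[\mathsf{u}]$ by a single (short) braid relation. The equivalence relation generated by short braids on cyclic words is $\sim$. A word is torically reduced if it remains a reduced word under any sequence of cyclic shifts and/or braid relations. For torically reduced $\mathsf{w}$, the cyclic commutativity class is $\mathcal{C}_{\mathrm{tor}}([\mathsf{w}])=\{[\mathsf{u}]:[\mathsf{u}]\sim[\mathsf{w}]\}$. Toric posets: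 for a finite graph $G$ and acyclic orientation $\omega$, converting a source vertex into a sink (reversing all edges at it) generates an equivalence relation $\equiv$ on acyclic orientations; the class $[\omega]$ is the toric poset $T(G,[\omega])$. Toric heap of a word $\mathsf{w}=s_{x_1}\cdots s_{x_m}$: let $G_\mathsf{w}$ be the graph on $[m]$ with an edge $\{i,j\}$ for each $i\neq j$ with $m(s_{x_i},s_{x_j})\neq2$, and $\omega_\mathsf{w}$ its orientation $i\to j$ for $i<j$; the toric heap is $\mathcal{T}(\mathsf{w})=(T(G_\mathsf{w},[\omega_\mathsf{w}]),\Gamma,\tau_\mathsf{w})$ with labeling $\tau_\mathsf{w}(i)=s_{x_i}$. A total toric extension of $\mathcal{T}(\mathsf{w})$ is a total toric order on $[m]$, i.e. a toric poset $T(K_m,[\omega'])$ on the complete graph $K_m$ (equivalently a linear ordering $(i_1,\dots,i_m)$ of $[m]$, orienting $i_a\to i_b$ for $a<b$, taken up to cyclic rotation), such that the restriction of $\omega'$ to the edges of $G_\mathsf{w}$ is toric equivalent to $\omega_\mathsf{w}$; it is recorded by the cyclic word $[s_{x_{i_1}}\cdots s_{x_{i_m}}]$. $\mathcal{L}_{\mathrm{tor}}(\mathcal{T}(\mathsf{w}))$ denotes the set of cyclic words so obtained from all total toric extensions of $\mathcal{T}(\mathsf{w})$. *)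

theory Defs
  imports "HOL-Algebra.Multiplicative_Group" "HOL-Algebra.Generated_Groups"
    "HOL-Library.Extended_Nat"
begin

section \<open>Coxeter systems\<close>

text \<open>
  The library function \<open>group.ord\<close> returns 0 for elements of infinite order.
\<close>

definition bond :: "('g, 'b) monoid_scheme \<Rightarrow> 'g \<Rightarrow> 'g \<Rightarrow> enat" where
  "bond W s t =
     (if group.ord W (s \<otimes>\<^bsub>W\<^esub> t) = 0 then \<infinity> else enat (group.ord W (s \<otimes>\<^bsub>W\<^esub> t)))"

definition word_prod :: "('g, 'b) monoid_scheme \<Rightarrow> 'g list \<Rightarrow> 'g" where
  "word_prod W w = foldr (\<lambda>x y. x \<otimes>\<^bsub>W\<^esub> y) w \<one>\<^bsub>W\<^esub>"

text \<open>
  Deletion of a relator \<open>(st)\<^sup>m\<close> with \<open>m = m(s,t)\<close> finite; for \<open>s = t\<close> the relator is \<open>ss\<close>.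
\<close>

definition relator_step :: "('g, 'b) monoid_scheme \<Rightarrow> 'g set \<Rightarrow> 'g list \<Rightarrow> 'g list \<Rightarrow> bool" where
  "relator_step W S u v \<longleftrightarrow>
     (\<exists>x y s t m. s \<in> S \<and> t \<in> S \<and> bond W s t = enat m \<and>
        u = x @ concat (replicate m [s, t]) @ y \<and> v = x @ y)"

text \<open>
  The group \<open>W\<close> is generated by the set \<open>S\<close> of involutions and has the presentation with
  generators \<open>S\<close> and relations \<open>(st)\<^sup>m = 1\<close>, \<open>m = m(s,t) < \<infinity>\<close>.  As the generators are
  involutions, the presentation can be expressed by words over \<open>S\<close> without formal inverses:
  two words represent the same element iff they are related by insertions and deletions
  of relators.
\<close>

definition coxeter_system :: "('g, 'b) monoid_scheme \<Rightarrow> 'g set \<Rightarrow> bool" where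
  "coxeter_system W S \<longleftrightarrow>
     group W \<and> S \<subseteq> carrier W \<and> generate W S = carrier W \<and>
     (\<forall>s\<in>S. group.ord W s = 2) \<and>
     (\<forall>u\<in>lists S. \<forall>v\<in>lists S.
        word_prod W u = word_prod W v \<longleftrightarrow> equivclp (relator_step W S) u v)"


section \<open>Words, braids and cyclic words\<close>

fun alternating :: "'g \<Rightarrow> 'g \<Rightarrow> nat \<Rightarrow> 'g list" where
  "alternating s t 0 = []"
| "alternating s t (Suc k) = s # alternating t s k"

definition braid_of_length ::
  "('g, 'b) monoid_scheme \<Rightarrow> 'g set \<Rightarrow> nat \<Rightarrow> 'g list \<Rightarrow> 'g list \<Rightarrow> bool" where
  "braid_of_length W S k u v \<longleftrightarrow>
     (\<exists>x y s t. s \<in> S \<and> t \<in> S \<and> s \<noteq> t \<and> bond W s t = enat k \<and>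
        u = x @ alternating s t k @ y \<and> v = x @ alternating t s k @ y)"

definition braid :: "('g, 'b) monoid_scheme \<Rightarrow> 'g set \<Rightarrow> 'g list \<Rightarrow> 'g list \<Rightarrow> bool" where
  "braid W S u v \<longleftrightarrow> (\<exists>k. braid_of_length W S k u v)"

definition short_braid :: "('g, 'b) monoid_scheme \<Rightarrow> 'g set \<Rightarrow> 'g list \<Rightarrow> 'g list \<Rightarrow> bool" where
  "short_braid W S u v \<longleftrightarrow> braid_of_length W S 2 u v"

definition reduced :: "('g, 'b) monoid_scheme \<Rightarrow> 'g set \<Rightarrow> 'g list \<Rightarrow> bool" where
  "reduced W S w \<longleftrightarrow>
     w \<in> lists S \<and> (\<forall>u\<in>lists S. word_prod W u = word_prod W w \<longrightarrow> length w \<le> length u)"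

text \<open>The cyclic word of the empty word is \<open>{[]}\<close>.\<close>

definition cyclic_word :: "'a list \<Rightarrow> 'a list set" where
  "cyclic_word w = {rotate n w | n. True}"

definition torically_reduced :: "('g, 'b) monoid_scheme \<Rightarrow> 'g set \<Rightarrow> 'g list \<Rightarrow> bool" where
  "torically_reduced W S w \<longleftrightarrow>
     (\<forall>u. (\<lambda>a b. b \<in> cyclic_word a \<or> braid W S a b)\<^sup>*\<^sup>* w u \<longrightarrow> reduced W S u)"

definition cyclic_words :: "'g set \<Rightarrow> 'g list set set" where
  "cyclic_words S = cyclic_word ` lists S"

definition differ_by_short_braid ::
  "('g, 'b) monoid_scheme \<Rightarrow> 'g set \<Rightarrow> 'g list set \<Rightarrow> 'g list set \<Rightarrow> bool" where
  "differ_by_short_braid W S A B \<longleftrightarrow>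
     A \<in> cyclic_words S \<and> B \<in> cyclic_words S \<and> (\<exists>w\<in>A. \<exists>u\<in>B. short_braid W S w u)"

definition cyclic_commutativity_class ::
  "('g, 'b) monoid_scheme \<Rightarrow> 'g set \<Rightarrow> 'g list set \<Rightarrow> 'g list set set" where
  "cyclic_commutativity_class W S A =
     {B \<in> cyclic_words S. equivclp (differ_by_short_braid W S) B A}"


section \<open>Toric posets\<close>

text \<open>
  A graph is a pair of a vertex set and a set of two-element sets of vertices.
\<close>

type_synonym 'v graph = "'v set \<times> 'v set set"

definition verts :: "'v graph \<Rightarrow> 'v set" where
  "verts G = fst G"

definition edges :: "'v graph \<Rightarrow> 'v set set" where
  "edges G = snd G"

definition complete_graph :: "'v set \<Rightarrow> 'v graph" where
  "complete_graph V = (V, {{i, j} | i j. i \<in> V \<and> j \<in> V \<and> i \<noteq> j})"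

definition acyclic_orientation :: "'v graph \<Rightarrow> ('v \<times> 'v) set \<Rightarrow> bool" where
  "acyclic_orientation G \<omega> \<longleftrightarrow>
     (\<forall>i j. (i, j) \<in> \<omega> \<longrightarrow> {i, j} \<in> edges G \<and> (j, i) \<notin> \<omega>) \<and>
     (\<forall>i j. {i, j} \<in> edges G \<longrightarrow> (i, j) \<in> \<omega> \<or> (j, i) \<in> \<omega>) \<and>
     acyclic \<omega>"

definition is_source :: "'v graph \<Rightarrow> ('v \<times> 'v) set \<Rightarrow> 'v \<Rightarrow> bool" where
  "is_source G \<omega> v \<longleftrightarrow> v \<in> verts G \<and> (\<forall>u. (u, v) \<notin> \<omega>)"

definition reverse_at :: "'v \<Rightarrow> ('v \<times> 'v) set \<Rightarrow> ('v \<times> 'v) set" where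
  "reverse_at v \<omega> =
     {(i, j). (i, j) \<in> \<omega> \<and> i \<noteq> v \<and> j \<noteq> v} \<union> {(j, i) | i j. (i, j) \<in> \<omega> \<and> (i = v \<or> j = v)}"

definition source_to_sink :: "'v graph \<Rightarrow> ('v \<times> 'v) set \<Rightarrow> ('v \<times> 'v) set \<Rightarrow> bool" where
  "source_to_sink G \<omega> \<omega>' \<longleftrightarrow>
     acyclic_orientation G \<omega> \<and> (\<exists>v. is_source G \<omega> v \<and> \<omega>' = reverse_at v \<omega>)"

definition toric_class :: "'v graph \<Rightarrow> ('v \<times> 'v) set \<Rightarrow> ('v \<times> 'v) set set" where
  "toric_class G \<omega> = {\<omega>'. acyclic_orientation G \<omega>' \<and> equivclp (source_to_sink G) \<omega>' \<omega>}"

type_synonym 'v toric_poset = "'v graph \<times> ('v \<times> 'v) set set"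

definition toric_poset :: "'v graph \<Rightarrow> ('v \<times> 'v) set \<Rightarrow> 'v toric_poset" where
  "toric_poset G \<omega> = (G, toric_class G \<omega>)"

definition restrict_orientation :: "'v graph \<Rightarrow> ('v \<times> 'v) set \<Rightarrow> ('v \<times> 'v) set" where
  "restrict_orientation G \<omega> = {(i, j). (i, j) \<in> \<omega> \<and> {i, j} \<in> edges G}"

definition total_toric_extensions :: "'v toric_poset \<Rightarrow> 'v toric_poset set" where
  "total_toric_extensions P =
     (let (G, C) = P; K = complete_graph (verts G) in
        {toric_poset K \<omega>' | \<omega>'. acyclic_orientation K \<omega>' \<and> restrict_orientation G \<omega>' \<in> C})"


section \<open>Toric heaps\<close>

definition coxeter_graph :: "('g, 'b) monoid_scheme \<Rightarrow> 'g set \<Rightarrow> 'g graph" where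
  "coxeter_graph W S = (S, {{s, t} | s t. s \<in> S \<and> t \<in> S \<and> bond W s t \<ge> 3})"

text \<open>
  The positions of a word \<open>w\<close> are numbered \<open>0, \<dots>, length w - 1\<close>.  Positions carrying equal
  letters are adjacent, since \<open>m(s,s) = 1\<close>.
\<close>

definition word_graph :: "('g, 'b) monoid_scheme \<Rightarrow> 'g list \<Rightarrow> nat graph" where
  "word_graph W w =
     ({..<length w},
      {{i, j} | i j. i < length w \<and> j < length w \<and> i \<noteq> j \<and> bond W (w ! i) (w ! j) \<noteq> 2})"

definition word_orientation :: "('g, 'b) monoid_scheme \<Rightarrow> 'g list \<Rightarrow> (nat \<times> nat) set" where
  "word_orientation W w = {(i, j). i < j \<and> {i, j} \<in> edges (word_graph W w)}"

type_synonym ('v, 'g) toric_heap = "'v toric_poset \<times> 'g graph \<times> ('v \<Rightarrow> 'g)"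

definition toric_heap ::
  "('g, 'b) monoid_scheme \<Rightarrow> 'g set \<Rightarrow> 'g list \<Rightarrow> (nat, 'g) toric_heap" where
  "toric_heap W S w =
     (toric_poset (word_graph W w) (word_orientation W w), coxeter_graph W S, \<lambda>i. w ! i)"

definition linear_orientation :: "'v list \<Rightarrow> ('v \<times> 'v) set" where
  "linear_orientation is = {(is ! a, is ! b) | a b. a < b \<and> b < length is}"

text \<open>
  The list \<open>is\<close> ranges over the linear orderings representing total toric extensions; orderings
  representing the same extension are rotations of each other and give the same cyclic word.
\<close>

definition L_tor :: "('v, 'g) toric_heap \<Rightarrow> 'g list set set" where
  "L_tor H =
     (let (P, \<Gamma>, \<tau>) = H; V = verts (fst P) in
        {cyclic_word (map \<tau> is) | is.
           distinct is \<and> set is = V \<and>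
           toric_poset (complete_graph V) (linear_orientation is) \<in> total_toric_extensions P})"

end

(* Restricted to the toric heap, total toric extensions are linear extensions of the acyclic
   orientations toric equivalent to the word orientation.  Turning a source into a sink corresponds
   to rotating a linear extension that starts with this source, so it does not change the cyclic
   word; two linear extensions of one and the same acyclic orientation are joined by transpositions
   of adjacent non-edges, which are the short braids. *)

theory Submission
  imports Defs
begin

section \<open>Cyclic words\<close>

lemma rotate_in_cyclic_word: "rotate n w \<in> cyclic_word w"
  by (auto simp: cyclic_word_def)

lemma self_in_cyclic_word: "w \<in> cyclic_word w"
  using rotate_in_cyclic_word[of 0 w] by simp

text \<open>Shifting is reversible: completing the full turn leads back to \<open>w\<close>, so both
  words have the same shifts.\<close>

lemma cyclic_word_eq:
  assumes "u \<in> cyclic_word w"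
  shows "cyclic_word u = cyclic_word w"
proof -
  obtain n where n: "u = rotate n w"
    using assms by (auto simp: cyclic_word_def)
  have "w = rotate (length w - n mod length w) u"
  proof (cases "w = []")
    case False
    then have "n mod length w \<le> length w"
      by (simp add: less_imp_le)
    then have "rotate (length w - n mod length w) (rotate (n mod length w) w) = w"
      by (simp add: rotate_rotate)
    then show ?thesis
      using n rotate_conv_mod[of n w] by simp
  qed (simp add: n)
  then show ?thesis
    using n unfolding cyclic_word_def by (metis rotate_rotate)
qed

section \<open>Orientations induced by linear orderings\<close>

lemma linear_orientation_Nil: "linear_orientation [] = {}"
  by (simp add: linear_orientation_def)

text \<open>Two positions \<open>a < b\<close> lie in the left block, in the right block, or on
  either side of the cut. This form and its \<open>Cons\<close> case let most later proofs work with
  sets of pairs instead of indices.\<close>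

lemma linear_orientation_append:
  "linear_orientation (xs @ ys) =
     linear_orientation xs \<union> linear_orientation ys \<union> set xs \<times> set ys"
proof (intro equalityI subsetI)
  fix p assume "p \<in> linear_orientation (xs @ ys)"
  then obtain a b where ab: "p = ((xs @ ys) ! a, (xs @ ys) ! b)" "a < b"
      "b < length xs + length ys"
    by (auto simp: linear_orientation_def)
  consider "b < length xs" | "a < length xs" "\<not> b < length xs" | "\<not> a < length xs"
    by blast
  then show "p \<in> linear_orientation xs \<union> linear_orientation ys \<union> set xs \<times> set ys"
  proof cases
    case 1
    then have "p = (xs ! a, xs ! b)"
      using ab by (simp add: nth_append)
    then show ?thesis
      using 1 ab unfolding linear_orientation_def by blast
  next
    case 2
    then show ?thesis
      using ab by (auto simp: nth_append)
  next
    case 3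
    then have "p = (ys ! (a - length xs), ys ! (b - length xs))"
      "a - length xs < b - length xs" "b - length xs < length ys"
      using ab by (auto simp: nth_append)
    then show ?thesis
      unfolding linear_orientation_def by blast
  qed
next
  fix p assume "p \<in> linear_orientation xs \<union> linear_orientation ys \<union> set xs \<times> set ys"
  then consider "p \<in> linear_orientation xs" | "p \<in> linear_orientation ys" | "p \<in> set xs \<times> set ys"
    by blast
  then have "\<exists>a b. p = ((xs @ ys) ! a, (xs @ ys) ! b) \<and> a < b \<and> b < length (xs @ ys)"
  proof cases
    case 1
    then obtain a b where "p = (xs ! a, xs ! b)" "a < b" "b < length xs"
      by (auto simp: linear_orientation_def)
    then show ?thesis
      by (intro exI[of _ a] exI[of _ b]) (simp add: nth_append)
  next
    case 2
    then obtain a b where "p = (ys ! a, ys ! b)" "a < b" "b < length ys"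
      by (auto simp: linear_orientation_def)
    then show ?thesis
      by (intro exI[of _ "length xs + a"] exI[of _ "length xs + b"]) simp
  next
    case 3
    then obtain a b where "p = (xs ! a, ys ! b)" "a < length xs" "b < length ys"
      by (auto simp: in_set_conv_nth)
    then show ?thesis
      by (intro exI[of _ a] exI[of _ "length xs + b"]) (simp add: nth_append)
  qed
  then show "p \<in> linear_orientation (xs @ ys)"
    by (auto simp: linear_orientation_def)
qed

lemma linear_orientation_singleton: "linear_orientation [x] = {}"
  by (simp add: linear_orientation_def)

lemma linear_orientation_Cons:
  "linear_orientation (x # xs) = linear_orientation xs \<union> {x} \<times> set xs"
  using linear_orientation_append[of "[x]" xs] by (simp add: linear_orientation_singleton)

lemma linear_orientation_subset: "linear_orientation xs \<subseteq> set xs \<times> set xs"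
  by (induction xs) (auto simp: linear_orientation_Nil linear_orientation_Cons)

lemma linear_orientation_total:
  "i \<in> set xs \<Longrightarrow> j \<in> set xs \<Longrightarrow> i \<noteq> j \<Longrightarrow>
     (i, j) \<in> linear_orientation xs \<or> (j, i) \<in> linear_orientation xs"
  by (induction xs) (auto simp: linear_orientation_Cons)

lemma linear_orientation_asym:
  "distinct xs \<Longrightarrow> (i, j) \<in> linear_orientation xs \<Longrightarrow> (j, i) \<notin> linear_orientation xs"
proof (induction xs)
  case (Cons x xs)
  then show ?case
    using linear_orientation_subset[of xs] by (auto simp: linear_orientation_Cons)
qed (simp add: linear_orientation_Nil)

lemma trans_linear_orientation: "distinct xs \<Longrightarrow> trans (linear_orientation xs)"
proof (induction xs)
  case (Cons x xs)
  then have "trans (linear_orientation xs)" "x \<notin> set xs"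
    by simp_all
  then show ?case
    using linear_orientation_subset[of xs]
    unfolding linear_orientation_Cons trans_def by blast
qed (simp add: linear_orientation_Nil)

text \<open>By transitivity the relation is its own transitive closure, so a cycle would be a loop,
  which asymmetry forbids.\<close>

lemma acyclic_linear_orientation:
  assumes "distinct xs" shows "acyclic (linear_orientation xs)"
  using linear_orientation_asym[OF assms] trans_linear_orientation[OF assms]
  by (auto simp: acyclic_def trancl_id)

lemma linear_orientation_upt: "linear_orientation [0..<n] = {(i, j). i < j \<and> j < n}"
proof (intro equalityI subsetI)
  fix p assume "p \<in> {(i, j). i < j \<and> j < n}"
  then obtain i j where "p = ([0..<n] ! i, [0..<n] ! j)" "i < j" "j < length [0..<n]"
    by auto
  then show "p \<in> linear_orientation [0..<n]"
    unfolding linear_orientation_def by blast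
qed (auto simp: linear_orientation_def)

section \<open>Restriction of toric equivalence\<close>

text \<open>The type \<open>graph\<close> admits arbitrary pairs; comparison with the complete graph
  excludes loops, edges leaving the vertex set and edges not of size two, all at once.\<close>

definition simple_graph :: "'v graph \<Rightarrow> bool" where
  "simple_graph G \<longleftrightarrow> finite (verts G) \<and> edges G \<subseteq> edges (complete_graph (verts G))"

lemma verts_complete_graph: "verts (complete_graph V) = V"
  by (simp add: verts_def complete_graph_def)

lemma edges_complete_graph:
  "{i, j} \<in> edges (complete_graph V) \<longleftrightarrow> i \<in> V \<and> j \<in> V \<and> i \<noteq> j"
  by (auto simp: edges_def complete_graph_def doubleton_eq_iff)

lemma simple_graph_edgeD:
  "simple_graph G \<Longrightarrow> {i, j} \<in> edges G \<Longrightarrow> i \<in> verts G \<and> j \<in> verts G \<and> i \<noteq> j"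
  unfolding simple_graph_def edges_complete_graph[symmetric] by blast

lemma restrict_orientation_iff:
  "(i, j) \<in> restrict_orientation G \<omega> \<longleftrightarrow> (i, j) \<in> \<omega> \<and> {i, j} \<in> edges G"
  by (simp add: restrict_orientation_def)

lemma acyclic_orientation_restrict:
  assumes "simple_graph G" "acyclic_orientation (complete_graph (verts G)) \<omega>"
  shows "acyclic_orientation G (restrict_orientation G \<omega>)"
proof -
  have "acyclic (restrict_orientation G \<omega>)"
    by (rule acyclic_subset[of \<omega>])
      (use assms(2) in \<open>auto simp: acyclic_orientation_def restrict_orientation_def\<close>)
  moreover have "(i, j) \<in> \<omega> \<or> (j, i) \<in> \<omega>" if "{i, j} \<in> edges G" for i j
    using assms(2) simple_graph_edgeD[OF assms(1) that]
    unfolding acyclic_orientation_def edges_complete_graph by blast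
  moreover have "(j, i) \<notin> \<omega>" if "(i, j) \<in> \<omega>" for i j
    using assms(2) that unfolding acyclic_orientation_def by blast
  ultimately show ?thesis
    unfolding acyclic_orientation_def restrict_orientation_iff
    by (simp add: insert_commute)
qed

text \<open>Reversal acts on each edge separately, and membership of an edge in \<open>G\<close>
  does not depend on its direction.\<close>

lemma restrict_reverse_at:
  "restrict_orientation G (reverse_at v \<omega>) = reverse_at v (restrict_orientation G \<omega>)"
  by (auto simp: restrict_orientation_def reverse_at_def insert_commute)

text \<open>A source stays a source when arrows are deleted, so a flip at \<open>v\<close> on the
  complete graph becomes a flip at the same \<open>v\<close> on \<open>G\<close>.\<close>

lemma source_to_sink_restrict:
  assumes "simple_graph G" "source_to_sink (complete_graph (verts G)) \<omega> \<omega>'"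
  shows "source_to_sink G (restrict_orientation G \<omega>) (restrict_orientation G \<omega>')"
  using assms acyclic_orientation_restrict[OF assms(1)]
  unfolding source_to_sink_def is_source_def
  by (auto simp: restrict_reverse_at restrict_orientation_iff verts_complete_graph)

lemma equivclp_map:
  assumes "equivclp r x y" and "\<And>x y. r x y \<Longrightarrow> equivclp s (f x) (f y)"
  shows "equivclp s (f x) (f y)"
  using assms(1)
proof (induction rule: equivclp_induct)
  case (step y z)
  then show ?case
    using assms(2) by (meson equivclp_sym equivclp_trans)
qed simp

section \<open>Rotations of linear orderings on the complete graph, and total toric
  extensions\<close>

lemma acyclic_orientation_linear:
  assumes "distinct xs"
  shows "acyclic_orientation (complete_graph (set xs)) (linear_orientation xs)"
  using assms linear_orientation_asym[OF assms] linear_orientation_subset[of xs]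
    linear_orientation_total[of _ xs] acyclic_linear_orientation[OF assms]
  unfolding acyclic_orientation_def edges_complete_graph by blast

text \<open>Only the arrows from \<open>x\<close> to the entries of \<open>xs\<close> touch
  \<open>x\<close>; reversed, they are the arrows into a last entry \<open>x\<close>.\<close>

lemma reverse_at_linear_orientation:
  assumes "distinct (x # xs)"
  shows "reverse_at x (linear_orientation (x # xs)) = linear_orientation (xs @ [x])"
  using assms linear_orientation_subset[of xs]
  unfolding linear_orientation_append linear_orientation_Cons linear_orientation_Nil reverse_at_def
  by auto

lemma source_to_sink_linear:
  assumes "distinct (x # xs)"
  shows "source_to_sink (complete_graph (set (x # xs)))
    (linear_orientation (x # xs)) (linear_orientation (xs @ [x]))"
proof -
  have "is_source (complete_graph (set (x # xs))) (linear_orientation (x # xs)) x"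
    using assms linear_orientation_subset[of xs]
    unfolding is_source_def verts_complete_graph linear_orientation_Cons by auto
  then show ?thesis
    using acyclic_orientation_linear[OF assms] reverse_at_linear_orientation[OF assms]
    unfolding source_to_sink_def by metis
qed

lemma equivclp_source_to_sink_rotate:
  assumes "distinct xs"
  shows "equivclp (source_to_sink (complete_graph (set xs)))
    (linear_orientation (rotate n xs)) (linear_orientation xs)"
proof (induction n)
  case (Suc n)
  show ?case
  proof (cases "rotate n xs")
    case (Cons y ys)
    have "distinct (y # ys)" "set (y # ys) = set xs"
      using assms by (simp_all flip: Cons)
    then have "source_to_sink (complete_graph (set xs))
        (linear_orientation (rotate n xs)) (linear_orientation (rotate (Suc n) xs))"
      using source_to_sink_linear[of y ys] by (simp add: Cons)
    then show ?thesis
      using Suc.IH by (meson converse_r_into_equivclp equivclp_trans)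
  qed (use Suc in simp)
qed simp

text \<open>
  A toric class on the complete graph is entirely contained in the fibre of one toric class of
  \<open>G\<close>, so the choice of its representative is irrelevant.
\<close>

lemma total_toric_extension_iff:
  assumes G: "simple_graph G" and xs: "distinct xs" "set xs = verts G"
  shows "toric_poset (complete_graph (verts G)) (linear_orientation xs)
           \<in> total_toric_extensions (toric_poset G \<omega>) \<longleftrightarrow>
         equivclp (source_to_sink G) (restrict_orientation G (linear_orientation xs)) \<omega>"
    (is "toric_poset ?K ?l \<in> _ \<longleftrightarrow> _")
proof
  have l: "acyclic_orientation ?K ?l"
    using acyclic_orientation_linear[OF xs(1)] xs(2) by simp
  show "toric_poset ?K ?l \<in> total_toric_extensions (toric_poset G \<omega>)"
    if "equivclp (source_to_sink G) (restrict_orientation G ?l) \<omega>"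
    using that l acyclic_orientation_restrict[OF G l]
    unfolding total_toric_extensions_def toric_poset_def toric_class_def by (auto simp: Let_def)
  assume "toric_poset ?K ?l \<in> total_toric_extensions (toric_poset G \<omega>)"
  then obtain \<omega>' where \<omega>': "toric_class ?K ?l = toric_class ?K \<omega>'"
      "equivclp (source_to_sink G) (restrict_orientation G \<omega>') \<omega>"
    unfolding total_toric_extensions_def toric_poset_def
    by (auto simp: Let_def toric_class_def[of G])
  \<comment> \<open>The witness \<open>\<omega>'\<close> need not be \<open>?l\<close>. Membership
    of \<open>?l\<close> in the common class yields a chain of flips between them, which restriction
    carries to \<open>G\<close>.\<close>
  have "?l \<in> toric_class ?K ?l"
    using l by (simp add: toric_class_def)
  then have "equivclp (source_to_sink ?K) ?l \<omega>'"
    unfolding \<omega>'(1) by (simp add: toric_class_def)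
  then have "equivclp (source_to_sink G) (restrict_orientation G ?l) (restrict_orientation G \<omega>')"
    by (rule equivclp_map) (use source_to_sink_restrict[OF G] in blast)
  then show "equivclp (source_to_sink G) (restrict_orientation G ?l) \<omega>"
    using \<omega>'(2) by (rule equivclp_trans)
qed

section \<open>Linear extensions of an acyclic orientation\<close>

text \<open>Topological sorting: put a minimal vertex first and recurse on the others. Intersecting
  with \<open>V \<times> V\<close> lets \<open>V\<close> shrink while \<open>\<omega>\<close> stays
  fixed.\<close>

lemma finite_acyclic_linear_extension:
  assumes "finite V" "acyclic \<omega>"
  shows "\<exists>xs. distinct xs \<and> set xs = V \<and> \<omega> \<inter> V \<times> V \<subseteq> linear_orientation xs"
  using assms(1)
proof (induction "card V" arbitrary: V)
  case (Suc n)
  have "wf (\<omega> \<inter> V \<times> V)"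
    using Suc.prems by (intro finite_acyclic_wf acyclic_subset[OF assms(2)]) auto
  moreover obtain a where "a \<in> V"
    using Suc.hyps(2) by fastforce
  ultimately obtain v where v: "v \<in> V" "\<And>u. (u, v) \<in> \<omega> \<inter> V \<times> V \<Longrightarrow> u \<notin> V"
    by (rule wfE_min) blast
  have "n = card (V - {v})" "finite (V - {v})"
    using Suc v(1) by simp_all
  then obtain xs where xs: "distinct xs" "set xs = V - {v}"
      "\<omega> \<inter> (V - {v}) \<times> (V - {v}) \<subseteq> linear_orientation xs"
    using Suc.hyps(1)[of "V - {v}"] by blast
  have "\<omega> \<inter> V \<times> V \<subseteq> linear_orientation (v # xs)"
    unfolding linear_orientation_Cons xs(2) using v(2) xs(3) by blast
  then show ?case
    using v(1) xs(1,2) by (intro exI[of _ "v # xs"]) auto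
qed (simp add: linear_orientation_Nil)

text \<open>Inclusion suffices for equality: \<open>\<omega>\<close> already directs every edge of
  \<open>G\<close>, and the linear ordering cannot contain the opposite direction as well.\<close>

lemma restrict_linear_extension:
  assumes "acyclic_orientation G \<omega>" "distinct xs" "\<omega> \<subseteq> linear_orientation xs"
  shows "restrict_orientation G (linear_orientation xs) = \<omega>"
proof (intro equalityI subrelI)
  fix i j assume "(i, j) \<in> restrict_orientation G (linear_orientation xs)"
  then have ij: "(i, j) \<in> linear_orientation xs" "{i, j} \<in> edges G"
    by (simp_all add: restrict_orientation_iff)
  then have "(i, j) \<in> \<omega> \<or> (j, i) \<in> \<omega>"
    using assms(1) by (simp add: acyclic_orientation_def)
  then show "(i, j) \<in> \<omega>"
    using assms(3) linear_orientation_asym[OF assms(2) ij(1)] by auto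
next
  fix i j assume "(i, j) \<in> \<omega>"
  then show "(i, j) \<in> restrict_orientation G (linear_orientation xs)"
    using assms(1,3) by (auto simp: acyclic_orientation_def restrict_orientation_iff)
qed

text \<open>Prepares a flip at \<open>v\<close>: with \<open>v\<close> in front, the flip becomes a
  rotation of the ordering. Since no arrow enters \<open>v\<close>, it may precede any linear
  extension of the rest.\<close>

lemma linear_extension_at_source:
  assumes "simple_graph G" "acyclic_orientation G \<omega>" "is_source G \<omega> v"
  shows "\<exists>xs. distinct (v # xs) \<and> set (v # xs) = verts G \<and>
    restrict_orientation G (linear_orientation (v # xs)) = \<omega>"
proof -
  have "finite (verts G - {v})" "acyclic \<omega>"
    using assms by (simp_all add: simple_graph_def acyclic_orientation_def)
  then obtain xs where xs: "distinct xs" "set xs = verts G - {v}"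
      "\<omega> \<inter> (verts G - {v}) \<times> (verts G - {v}) \<subseteq> linear_orientation xs"
    using finite_acyclic_linear_extension by blast
  have "\<omega> \<subseteq> verts G \<times> verts G"
    using assms(2) simple_graph_edgeD[OF assms(1)] unfolding acyclic_orientation_def by auto
  moreover have "(i, v) \<notin> \<omega>" "v \<in> verts G" for i
    using assms(3) by (simp_all add: is_source_def)
  ultimately have "\<omega> \<subseteq> linear_orientation (v # xs)"
    using xs unfolding linear_orientation_Cons by blast
  then show ?thesis
    using xs assms(2,3) unfolding is_source_def
    by (intro exI[of _ xs] conjI restrict_linear_extension) auto
qed

text \<open>The counterpart of a short braid on orderings: for distinct positions of a word over
  \<open>S\<close> and \<open>G\<close> its word graph, the swapped letters have bond strength
  2.\<close>

inductive commute :: "'v graph \<Rightarrow> 'v list \<Rightarrow> 'v list \<Rightarrow> bool" for G where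
  "{i, j} \<notin> edges G \<Longrightarrow> commute G (xs @ i # j # ys) (xs @ j # i # ys)"

lemma commute_distinct_set:
  "commute G xs ys \<Longrightarrow> set ys = set xs \<and> (distinct ys \<longleftrightarrow> distinct xs)"
  by (induction rule: commute.induct) auto

lemma commute_Cons: "commute G xs ys \<Longrightarrow> commute G (z # xs) (z # ys)"
  by (metis append_Cons commute.simps)

lemma commute_rtranclp_Cons: "(commute G)\<^sup>*\<^sup>* xs ys \<Longrightarrow> (commute G)\<^sup>*\<^sup>* (z # xs) (z # ys)"
  by (induction rule: rtranclp_induct) (auto intro: rtranclp.rtrancl_into_rtrancl commute_Cons)

lemma commute_to_front:
  "\<forall>x\<in>set xs. {x, z} \<notin> edges G \<Longrightarrow> (commute G)\<^sup>*\<^sup>* (xs @ z # ys) (z # xs @ ys)"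
proof (induction xs)
  case (Cons x xs)
  then have "(commute G)\<^sup>*\<^sup>* (x # xs @ z # ys) (x # z # xs @ ys)"
    by (intro commute_rtranclp_Cons) simp
  moreover have "commute G (x # z # xs @ ys) (z # x # xs @ ys)"
    using commute.intros[of x z G "[]"] Cons.prems by simp
  ultimately show ?case
    by (metis append_Cons rtranclp.rtrancl_into_rtrancl)
qed simp

text \<open>The swap affects only the arrows between \<open>i\<close> and \<open>j\<close>, which
  restriction to \<open>G\<close> discards.\<close>

lemma commute_restrict_orientation:
  "commute G xs ys \<Longrightarrow>
     restrict_orientation G (linear_orientation xs) = restrict_orientation G (linear_orientation ys)"
  by (induction rule: commute.induct)
    (auto simp: restrict_orientation_def linear_orientation_append linear_orientation_Cons
       linear_orientation_Nil insert_commute)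

text \<open>The first entry \<open>y\<close> of \<open>ys\<close> can be moved to the front of
  \<open>xs\<close> by swaps; then \<open>y\<close> is removed from both lists and the argument
  repeats.\<close>

lemma commute_rtranclp_if_same_restriction:
  assumes "distinct xs" "distinct ys" "set xs = set ys"
    and "restrict_orientation G (linear_orientation xs) =
         restrict_orientation G (linear_orientation ys)"
  shows "(commute G)\<^sup>*\<^sup>* xs ys"
  using assms
proof (induction ys arbitrary: xs)
  case (Cons y ys)
  then obtain as bs where xs: "xs = as @ y # bs"
    by (metis list.set_intros(1) split_list)
  have tail: "set (as @ bs) = set ys" "distinct (as @ bs)" "y \<notin> set ys" "distinct ys"
    using Cons.prems xs by auto
  \<comment> \<open>An edge between \<open>a\<close> and \<open>y\<close> would be directed from
    \<open>a\<close> to \<open>y\<close> by \<open>xs\<close>, hence also by \<open>y # ys\<close>,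
    where nothing precedes \<open>y\<close>.\<close>
  have "{a, y} \<notin> edges G" if "a \<in> set as" for a
  proof
    assume "{a, y} \<in> edges G"
    moreover have "(a, y) \<in> linear_orientation xs"
      using that unfolding xs linear_orientation_append by simp
    ultimately have "(a, y) \<in> linear_orientation (y # ys)"
      using Cons.prems(4) by (metis restrict_orientation_iff)
    then show False
      using tail(3) linear_orientation_subset[of ys] that tail(1)
      by (auto simp: linear_orientation_Cons)
  qed
  then have to_front: "(commute G)\<^sup>*\<^sup>* xs (y # as @ bs)"
    unfolding xs by (simp add: commute_to_front)
  then have "restrict_orientation G (linear_orientation xs) =
      restrict_orientation G (linear_orientation (y # as @ bs))"
    by (induction rule: rtranclp_induct) (auto dest: commute_restrict_orientation)
  then have eq: "restrict_orientation G (linear_orientation (y # as @ bs)) =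
      restrict_orientation G (linear_orientation (y # ys))"
    using Cons.prems(4) by simp
  \<comment> \<open>As \<open>y\<close> is not in \<open>ys\<close>, the intersection removes
    exactly the arrows at \<open>y\<close>, so the equality \<open>eq\<close> passes to the
    tails.\<close>
  have strip: "restrict_orientation G (linear_orientation zs) =
      restrict_orientation G (linear_orientation (y # zs)) \<inter> set ys \<times> set ys"
    if "set zs = set ys" for zs
    using that tail(3) linear_orientation_subset[of zs]
    unfolding linear_orientation_Cons restrict_orientation_def by blast
  have "restrict_orientation G (linear_orientation (as @ bs)) =
      restrict_orientation G (linear_orientation ys)"
    using strip[OF tail(1)] strip[OF refl] eq by simp
  then have "(commute G)\<^sup>*\<^sup>* (as @ bs) ys"
    using Cons.IH tail by blast
  then show ?case
    using to_front by (meson commute_rtranclp_Cons rtranclp_trans)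
qed simp

text \<open>
  The relation \<open>P\<close> stands for ``the orderings give equivalent cyclic words''.
\<close>

lemma toric_equivalent_linear_orderings:
  assumes G: "simple_graph G"
    and refl: "\<And>xs. P xs xs" and sym: "\<And>xs ys. P xs ys \<Longrightarrow> P ys xs"
    and trans: "\<And>xs ys zs. P xs ys \<Longrightarrow> P ys zs \<Longrightarrow> P xs zs"
    and rotate: "\<And>x xs. distinct (x # xs) \<Longrightarrow> set (x # xs) = verts G \<Longrightarrow> P (x # xs) (xs @ [x])"
    and commute: "\<And>xs ys. distinct xs \<Longrightarrow> set xs = verts G \<Longrightarrow> commute G xs ys \<Longrightarrow> P xs ys"
    and xs: "distinct xs" "set xs = verts G" and ys: "distinct ys" "set ys = verts G"
    and equiv: "equivclp (source_to_sink G) (restrict_orientation G (linear_orientation xs))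
      (restrict_orientation G (linear_orientation ys))"
  shows "P xs ys"
proof -
  \<comment> \<open>For an acyclic orientation \<open>\<omega>\<close> of \<open>G\<close>, these
    \<open>zs\<close> are its linear extensions.\<close>
  define Q where "Q = (\<lambda>\<omega> zs. distinct zs \<and> set zs = verts G \<and>
    restrict_orientation G (linear_orientation zs) = \<omega>)"
  have same: "P as bs" if "Q \<omega> as" "Q \<omega> bs" for \<omega> as bs
  proof -
    have "(commute G)\<^sup>*\<^sup>* as bs"
      using that unfolding Q_def by (intro commute_rtranclp_if_same_restriction) auto
    then have "P as bs \<and> distinct bs \<and> set bs = verts G"
    proof (induction rule: rtranclp_induct)
      case base
      then show ?case
        using that refl by (simp add: Q_def)
    next
      case (step bs cs)
      then have "P as cs"
        using trans[of as bs cs] commute[of bs cs] by simp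
      moreover have "distinct cs \<and> set cs = verts G"
        using step.IH commute_distinct_set[OF step.hyps(2)] by simp
      ultimately show ?case ..
    qed
    then show ?thesis ..
  qed
  \<comment> \<open>A linear extension starting with the flipped source is chosen; its rotation by
    one extends the flipped orientation.\<close>
  have source_step: "\<exists>as bs. Q \<omega> as \<and> Q \<omega>' bs \<and> P as bs" if s: "source_to_sink G \<omega> \<omega>'" for \<omega> \<omega>'
  proof -
    obtain v where v: "acyclic_orientation G \<omega>" "is_source G \<omega> v" "\<omega>' = reverse_at v \<omega>"
      using s by (auto simp: source_to_sink_def)
    obtain zs where zs: "distinct (v # zs)" "set (v # zs) = verts G"
        "restrict_orientation G (linear_orientation (v # zs)) = \<omega>"
      using linear_extension_at_source[OF G v(1,2)] by blast
    then have "Q \<omega>' (zs @ [v])"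
      using v(3) reverse_at_linear_orientation[OF zs(1)]
      by (auto simp: Q_def simp flip: restrict_reverse_at)
    moreover have "Q \<omega> (v # zs)"
      using zs by (simp add: Q_def)
    ultimately show ?thesis
      using rotate[OF zs(1,2)] by blast
  qed
  \<comment> \<open>The claim covers all linear extensions of \<open>\<omega>\<close>, because the
    extension suited to the next flip may differ from the one reached by the previous flip.\<close>
  have "\<forall>zs. Q \<omega> zs \<longrightarrow> P xs zs"
    if "equivclp (source_to_sink G) (restrict_orientation G (linear_orientation xs)) \<omega>" for \<omega>
    using that
  proof (induction rule: equivclp_induct)
    case base
    have "Q (restrict_orientation G (linear_orientation xs)) xs"
      using xs by (simp add: Q_def)
    then show ?case
      using same by blast
  next
    case (step \<omega> \<omega>')
    then obtain as bs where ab: "Q \<omega> as" "Q \<omega>' bs" "P as bs"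
      using source_step sym by metis
    show ?case
    proof (intro allI impI)
      fix zs assume "Q \<omega>' zs"
      then have "P bs zs"
        using same ab(2) by simp
      moreover have "P xs as"
        using step.IH ab(1) by simp
      ultimately show "P xs zs"
        using ab(3) by (meson trans)
    qed
  qed
  then show ?thesis
    using equiv ys by (simp add: Q_def)
qed

section \<open>Toric heaps of words\<close>

lemma simple_graph_word_graph: "simple_graph (word_graph W w)"
  by (auto simp: simple_graph_def word_graph_def verts_def edges_def complete_graph_def)

lemma verts_word_graph: "verts (word_graph W w) = {..<length w}"
  by (simp add: verts_def word_graph_def)

text \<open>Places \<open>w\<close> itself, read in its natural order, among the orderings to be
  compared.\<close>

lemma word_orientation_eq:
  "word_orientation W w = restrict_orientation (word_graph W w) (linear_orientation [0..<length w])"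
  using simple_graph_edgeD[OF simple_graph_word_graph, of _ _ W w]
  unfolding word_orientation_def restrict_orientation_def linear_orientation_upt verts_word_graph
  by blast

text \<open>Eliminates toric classes on the complete graph; only flips on the word graph
  remain.\<close>

lemma L_tor_eq:
  "L_tor (toric_heap W S w) = {cyclic_word (map ((!) w) xs) | xs.
     distinct xs \<and> set xs = {..<length w} \<and>
     equivclp (source_to_sink (word_graph W w))
       (restrict_orientation (word_graph W w) (linear_orientation xs)) (word_orientation W w)}"
proof -
  have "fst (toric_poset (word_graph W w) \<omega>) = word_graph W w" for \<omega>
    by (simp add: toric_poset_def)
  then show ?thesis
    using total_toric_extension_iff[OF simple_graph_word_graph, of _ W w]
    by (simp add: L_tor_def toric_heap_def Let_def verts_word_graph cong: conj_cong)
qed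

section \<open>Bond strengths and short braids\<close>

lemma coxeter_system_involution:
  assumes "coxeter_system W S" "s \<in> S"
  shows "s \<in> carrier W" "s \<otimes>\<^bsub>W\<^esub> s = \<one>\<^bsub>W\<^esub>"
proof -
  interpret group W
    using assms by (simp add: coxeter_system_def)
  show s: "s \<in> carrier W"
    using assms by (auto simp: coxeter_system_def)
  have "s [^]\<^bsub>W\<^esub> (2::nat) = \<one>\<^bsub>W\<^esub>"
    using assms pow_ord_eq_1[OF s] by (simp add: coxeter_system_def)
  then show "s \<otimes>\<^bsub>W\<^esub> s = \<one>\<^bsub>W\<^esub>"
    using s by (simp add: numeral_2_eq_2)
qed

text \<open>For involutions, \<open>t s\<close> is the inverse of \<open>s t\<close>, and inverse
  elements have the same order.\<close>

lemma bond_commute: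
  assumes "coxeter_system W S" "s \<in> S" "t \<in> S"
  shows "bond W s t = bond W t s"
proof -
  interpret group W
    using assms by (simp add: coxeter_system_def)
  note s = coxeter_system_involution[OF assms(1,2)]
  note t = coxeter_system_involution[OF assms(1,3)]
  have "inv\<^bsub>W\<^esub> (s \<otimes>\<^bsub>W\<^esub> t) = t \<otimes>\<^bsub>W\<^esub> s"
    using s t by (simp add: inv_mult_group inv_equality)
  then have "ord (t \<otimes>\<^bsub>W\<^esub> s) = ord (s \<otimes>\<^bsub>W\<^esub> t)"
    using s t ord_inv[of "s \<otimes>\<^bsub>W\<^esub> t"] by simp
  then show ?thesis
    by (simp add: bond_def)
qed

lemma bond_self:
  assumes "coxeter_system W S" "s \<in> S"
  shows "bond W s s = 1"
proof -
  interpret group W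
    using assms by (simp add: coxeter_system_def)
  show ?thesis
    using coxeter_system_involution[OF assms] by (simp add: bond_def one_enat_def)
qed

text \<open>An edge is an unordered pair, so its witnesses may come in either order; symmetry of the
  bond reconciles the two.\<close>

lemma word_graph_edge_iff:
  assumes "coxeter_system W S" "w \<in> lists S" "i < length w" "j < length w" "i \<noteq> j"
  shows "{i, j} \<in> edges (word_graph W w) \<longleftrightarrow> bond W (w ! i) (w ! j) \<noteq> 2"
proof -
  have "w ! i \<in> S" "w ! j \<in> S"
    using assms by auto
  then show ?thesis
    using assms bond_commute[OF assms(1)]
    by (auto simp: word_graph_def edges_def doubleton_eq_iff)
qed

lemma short_braid_iff:
  fixes W :: "('a, 'b) monoid_scheme"
  shows "short_braid W S u v \<longleftrightarrow> (\<exists>x y s t. s \<in> S \<and> t \<in> S \<and> s \<noteq> t \<and> bond W s t = 2 \<and>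
     u = x @ s # t # y \<and> v = x @ t # s # y)"
proof -
  have "alternating s t 2 = [s, t]" for s t :: 'a
    by (simp add: numeral_2_eq_2)
  then show ?thesis
    by (simp add: short_braid_def braid_of_length_def numeral_eq_enat)
qed

lemma symp_differ_by_short_braid:
  assumes "coxeter_system W S"
  shows "symp (differ_by_short_braid W S)"
  using bond_commute[OF assms]
  unfolding symp_def differ_by_short_braid_def short_braid_iff by metis

theorem mainTheorem3:
  fixes W :: "('g, 'b) monoid_scheme" and S :: "'g set" and w :: "'g list"
  assumes "coxeter_system W S"
    and "torically_reduced W S w"
  shows "L_tor (toric_heap W S w) = cyclic_commutativity_class W S (cyclic_word w)"
proof -
  let ?G = "word_graph W w" and ?V = "{..<length w}"
  let ?R = "\<lambda>xs. restrict_orientation ?G (linear_orientation xs)"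
  let ?eq = "equivclp (differ_by_short_braid W S)"
  \<comment> \<open>Zero moves already show that \<open>w\<close> is reduced, and reduced words are
    words over \<open>S\<close>.\<close>
  have w: "w \<in> lists S"
    using assms(2) unfolding torically_reduced_def reduced_def by blast
  have map_S: "map ((!) w) xs \<in> lists S" if "set xs = ?V" for xs
    using that w by (auto simp: subset_iff)
  have map_id: "map ((!) w) [0..<length w] = w"
    by (rule map_nth)

  have commute_step: "?eq (cyclic_word (map ((!) w) xs)) (cyclic_word (map ((!) w) ys))"
    if xs: "distinct xs" "set xs = ?V" and c: "commute ?G xs ys" for xs ys
  proof -
    obtain as bs i j where ij: "xs = as @ i # j # bs" "ys = as @ j # i # bs" "{i, j} \<notin> edges ?G"
      using c by cases
    have ij': "i < length w" "j < length w" "i \<noteq> j" "set ys = ?V"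
      using xs ij by auto
    then have bond: "bond W (w ! i) (w ! j) = 2"
      using ij(3) word_graph_edge_iff[OF assms(1) w] by blast
    have S: "w ! i \<in> S" "w ! j \<in> S"
      using w ij' by auto
    \<comment> \<open>A short braid needs distinct letters; equal ones would have bond strength
      1.\<close>
    have ne: "w ! i \<noteq> w ! j"
    proof
      assume "w ! i = w ! j"
      then have "(1::enat) = 2"
        using bond bond_self[OF assms(1) S(1)] by simp
      then show False
        by simp
    qed
    have "short_braid W S (map ((!) w) xs) (map ((!) w) ys)"
      unfolding short_braid_iff
      by (intro exI[of _ "map ((!) w) as"] exI[of _ "map ((!) w) bs"] exI[of _ "w ! i"]
          exI[of _ "w ! j"]) (use bond S ne ij in simp)
    then have "differ_by_short_braid W S (cyclic_word (map ((!) w) xs)) (cyclic_word (map ((!) w) ys))"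
      using map_S xs ij' self_in_cyclic_word
      unfolding differ_by_short_braid_def cyclic_words_def by blast
    then show ?thesis
      by (rule r_into_equivclp)
  qed

  have rotate_step: "cyclic_word (map ((!) w) (x # xs)) = cyclic_word (map ((!) w) (xs @ [x]))" for x xs
    using rotate_in_cyclic_word[of 1 "map ((!) w) (x # xs)"]
    by (intro cyclic_word_eq[symmetric]) simp

  have in_class: "cyclic_word (map ((!) w) xs) \<in> cyclic_commutativity_class W S (cyclic_word w)"
    if xs: "distinct xs" "set xs = ?V" "equivclp (source_to_sink ?G) (?R xs) (word_orientation W w)"
    for xs
  proof -
    \<comment> \<open>The ordering \<open>xs\<close> is compared with the natural one, which spells
      \<open>w\<close>: rotations preserve the cyclic word, and swaps give short braids.\<close>
    have "?eq (cyclic_word (map ((!) w) xs)) (cyclic_word (map ((!) w) [0..<length w]))"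
      using simple_graph_word_graph
    proof (rule toric_equivalent_linear_orderings
        [where P = "\<lambda>xs ys. ?eq (cyclic_word (map ((!) w) xs)) (cyclic_word (map ((!) w) ys))"])
      show "equivclp (source_to_sink ?G) (?R xs) (?R [0..<length w])"
        using xs(3) by (simp add: word_orientation_eq)
      show "?eq (cyclic_word (map ((!) w) as)) (cyclic_word (map ((!) w) cs))"
        if "?eq (cyclic_word (map ((!) w) as)) (cyclic_word (map ((!) w) bs))"
          "?eq (cyclic_word (map ((!) w) bs)) (cyclic_word (map ((!) w) cs))" for as bs cs
        using that by (rule equivclp_trans)
      show "?eq (cyclic_word (map ((!) w) (x # xs))) (cyclic_word (map ((!) w) (xs @ [x])))" for x xs
        by (simp only: rotate_step equivclp_refl)
      show "?eq (cyclic_word (map ((!) w) as)) (cyclic_word (map ((!) w) bs))"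
        if "distinct as" "set as = verts ?G" "commute ?G as bs" for as bs
        using that commute_step by (simp add: verts_word_graph)
    qed (use xs in \<open>auto simp: verts_word_graph lessThan_atLeast0
        elim: equivclp_sym\<close>)
    then show ?thesis
      using map_S[OF xs(2)] map_id unfolding cyclic_commutativity_class_def cyclic_words_def
      by auto
  qed
  have in_L_tor: "B \<in> L_tor (toric_heap W S w)" if "?eq (cyclic_word w) B" for B
    using that
  proof (induction rule: equivclp_induct)
    case base
    show ?case
      unfolding L_tor_eq word_orientation_eq
      by (rule CollectI, rule exI[of _ "[0..<length w]"]) (auto simp: map_id)
  next
    case (step A B)
    \<comment> \<open>The chain may use the relation in either direction; symmetry reduces this to
      one case.\<close>
    have "differ_by_short_braid W S A B"
      using step.hyps(2) sympD[OF symp_differ_by_short_braid[OF assms(1)]] by blast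
    then obtain u v where uv: "u \<in> A" "v \<in> B" "short_braid W S u v" "B \<in> cyclic_words S"
      unfolding differ_by_short_braid_def by blast
    obtain xs where xs: "A = cyclic_word (map ((!) w) xs)" "distinct xs" "set xs = ?V"
        "equivclp (source_to_sink ?G) (?R xs) (word_orientation W w)"
      using step.IH unfolding L_tor_eq by blast
    \<comment> \<open>The braid acts on some shift \<open>u\<close> of the word spelled by
      \<open>xs\<close>, so \<open>xs\<close> is rotated to match. On the complete graph this
      rotation is a chain of flips, which restricts to the word graph.\<close>
    obtain n where n: "u = map ((!) w) (rotate n xs)"
      using uv(1) unfolding xs(1) by (auto simp: cyclic_word_def rotate_map)
    have "equivclp (source_to_sink ?G) (?R (rotate n xs)) (?R xs)"
      using equivclp_source_to_sink_rotate[OF xs(2), of n]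
    proof (rule equivclp_map)
      fix \<omega> \<omega>' assume "source_to_sink (complete_graph (set xs)) \<omega> \<omega>'"
      then show "equivclp (source_to_sink ?G) (restrict_orientation ?G \<omega>) (restrict_orientation ?G \<omega>')"
        using source_to_sink_restrict[OF simple_graph_word_graph[of W w]] xs(3)
        by (simp add: verts_word_graph r_into_equivclp)
    qed
    then have R: "equivclp (source_to_sink ?G) (?R (rotate n xs)) (word_orientation W w)"
      using xs(4) by (rule equivclp_trans)
    obtain x y s t where st: "bond W s t = 2" "u = x @ s # t # y" "v = x @ t # s # y"
      using uv(3) unfolding short_braid_iff by blast
    \<comment> \<open>The braid is lifted from letters to positions: the factorization of
      \<open>u\<close> splits the ordering that spells it.\<close>
    obtain as i j bs where as: "rotate n xs = as @ i # j # bs" "x = map ((!) w) as"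
        "s = w ! i" "t = w ! j" "y = map ((!) w) bs"
      using n st(2) by (auto simp: append_eq_map_conv Cons_eq_map_conv)
    have perm: "distinct (as @ i # j # bs)" "set (as @ i # j # bs) = ?V"
      using xs(2,3) by (simp_all flip: as(1))
    then have "{i, j} \<notin> edges ?G"
      using word_graph_edge_iff[OF assms(1) w, of i j] st(1) as(3,4) by auto
    \<comment> \<open>Swapping the two positions leaves the restricted orientation, and hence its
      toric class, unchanged.\<close>
    then have "?R (as @ i # j # bs) = ?R (as @ j # i # bs)"
      by (intro commute_restrict_orientation commute.intros)
    then have "equivclp (source_to_sink ?G) (?R (as @ j # i # bs)) (word_orientation W w)"
      using R as(1) by simp
    \<comment> \<open>A cyclic word is determined by any of its members, here
      \<open>v\<close>.\<close>
    moreover have "B = cyclic_word (map ((!) w) (as @ j # i # bs))"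
      using uv(2,4) st(3) as(2-5) cyclic_word_eq[of v] unfolding cyclic_words_def by auto
    moreover have "distinct (as @ j # i # bs)" "set (as @ j # i # bs) = ?V"
      using perm by auto
    ultimately show ?case
      unfolding L_tor_eq by blast
  qed
  show ?thesis
  proof (intro equalityI subsetI)
    fix B assume "B \<in> cyclic_commutativity_class W S (cyclic_word w)"
    then have "?eq (cyclic_word w) B"
      by (simp add: cyclic_commutativity_class_def equivclp_sym)
    then show "B \<in> L_tor (toric_heap W S w)"
      by (rule in_L_tor)
  next
    fix B assume "B \<in> L_tor (toric_heap W S w)"
    then obtain xs where "B = cyclic_word (map ((!) w) xs)" "distinct xs" "set xs = ?V"
        "equivclp (source_to_sink ?G) (?R xs) (word_orientation W w)"
      unfolding L_tor_eq by blast
    then show "B \<in> cyclic_commutativity_class W S (cyclic_word w)"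
      using in_class by simp
  qed
qed

end
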